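(* Let $n$ be an integer and let \[ L(n) = p(n) + \sum_{j\geq 1} (-1)^j \Big( p\big(n - j(5j-3)/2\big) + p\big(n-j(5j+3)/2\big) \Big) = p(n) - p(n-1) - p(n-4) + p(n-7) + p(n-13) - p(n-18) - p(n-27) + \cdots. \] For $i\in\mathbb{Z}$ put \[ r^e_i = 60i^2-8i,\quad r^o_i = 60i^2+52i+11,\quad s^e_i = 60i^2+32i+4,\quad s^o_i = 60i^2-28i+3 \] (these are respectively the even and odd terms of the sequence $15k^2-4k$, $k\in\mathbb{Z}$, and the even and odd terms of the sequence $15k^2-14k+3$, $k\in\mathbb{Z}$). If $n$ is even, then \[ L(n) = \sum_{i\in\mathbb{Z}} \left( p\!\left(\frac{n-r^e_i}{2}\right) - p\!\left(\frac{n-s^e_i}{2}\right)\right), \] and if $n$ is odd, then \[ L(n) = \sum_{i\in\mathbb{Z}} \left( -p\!\left(\frac{n-r^o_i}{2}\right) + p\!\left(\frac{n-s^o_i}{2}\right)\right). \]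
   Context: $p(m)$ denotes the number of partitions of the integer $m$, with $p(0)=1$ and $p(m)=0$ for $m<0$ (so all sums above are finite). *)

theory Defs
  imports "HOL-Analysis.Analysis" "HOL-Library.Multiset"
begin

definition partition_count :: "int \<Rightarrow> int" where
  "partition_count m =
     (if m < 0 then 0
      else int (card {M :: nat multiset. (\<forall>x \<in># M. 0 < x) \<and> sum_mset M = nat m}))"

definition L :: "int \<Rightarrow> int" where
  "L n = partition_count n +
     (\<Sum>\<^sub>\<infinity>j\<in>{1::int..}. (-1) ^ nat j *
        (partition_count (n - j * (5 * j - 3) div 2) + partition_count (n - j * (5 * j + 3) div 2)))"

definition r_e :: "int \<Rightarrow> int" where "r_e i = 60 * i^2 - 8 * i"
definition r_o :: "int \<Rightarrow> int" where "r_o i = 60 * i^2 + 52 * i + 11"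
definition s_e :: "int \<Rightarrow> int" where "s_e i = 60 * i^2 + 32 * i + 4"
definition s_o :: "int \<Rightarrow> int" where "s_o i = 60 * i^2 - 28 * i + 3"

end

theory Submission
  imports Defs "HOL-Computational_Algebra.Formal_Power_Series"
begin

text \<open>
  Write \<open>(x, y, \<dots>; q)\<close> for the infinite \<open>q\<close>-Pochhammer symbol and \<open>P\<close> for the partition series.
  By the Jacobi triple product the generating function of \<open>L\<close> is \<open>P(q) f(q)\<close> with
  \<open>f(q) = (q, q^4, q^5; q^5)\<close>. The right-hand sides are the even and odd part of
  \<open>P(q^2) g(q)\<close> with \<open>g(q) = \<Sum>k. (-1)^k (q^(15k^2 - 4k) + q^(15k^2 - 14k + 3))\<close>.
  The series \<open>g\<close> is an instance of the quintuple product: multiply the theta series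
  \<open>\<Sum>m. q^(5m^2 + 2m)\<close> and \<open>\<Sum>n. (-1)^n q^(10n^2 - 6n)\<close> and split the double sum
  according to \<open>m - n\<close> modulo 3; one class cancels and the other two add up to
  \<open>g(q) (q^20; q^20)\<close>. Rearranging the infinite products then gives
  \<open>f(q) (q^2; q^2) = g(q) (q; q)\<close>, that is \<open>P(q) f(q) = P(q^2) g(q)\<close>.
\<close>

unbundle no vec_syntax and fps_syntax

section \<open>Infinite products of formal power series\<close>

text \<open>Convergence of power series means that each coefficient is eventually constant, and the
  \<open>n\<close>-th coefficient of a product involves only the finitely many coefficients up to
  \<open>n\<close>.\<close>

lemma tendsto_fps_mult:
  fixes f g :: "'b \<Rightarrow> 'a::comm_ring_1 fps"
  assumes "(f \<longlongrightarrow> a) F" "(g \<longlongrightarrow> b) F"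
  shows "((\<lambda>x. f x * g x) \<longlongrightarrow> a * b) F"
proof (rule tendsto_fpsI)
  fix n
  have "eventually (\<lambda>x. \<forall>i\<in>{..n}. f x $ i = a $ i) F"
    "eventually (\<lambda>x. \<forall>i\<in>{..n}. g x $ i = b $ i) F"
    using assms by (auto simp: tendsto_fps_iff eventually_ball_finite_distrib)
  then show "eventually (\<lambda>x. (f x * g x) $ n = (a * b) $ n) F"
    by eventually_elim (auto simp: fps_mult_nth intro!: sum.cong)
qed

lemma tendsto_fps_prod:
  fixes f :: "'i \<Rightarrow> 'b \<Rightarrow> 'a::comm_ring_1 fps"
  assumes "\<And>i. i \<in> I \<Longrightarrow> (f i \<longlongrightarrow> a i) F"
  shows "((\<lambda>x. \<Prod>i\<in>I. f i x) \<longlongrightarrow> (\<Prod>i\<in>I. a i)) F"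
  using assms by (induction I rule: infinite_finite_induct) (auto intro: tendsto_fps_mult)

text \<open>The product of \<open>qfactor s (a * k + b)\<close> over all \<open>k\<close> is the
  Pochhammer symbol \<open>(- s q^b; q^a)\<close>. Both signs occur: the quintuple product combines
  an alternating theta series with one that has no signs.\<close>

definition qfactor :: "int \<Rightarrow> nat \<Rightarrow> int fps" where
  "qfactor s m = 1 + fps_const s * fps_X ^ m"

text \<open>The \<open>n\<close>-th coefficient of the infinite product only depends on the first \<open>n + 1\<close> factors,
  provided \<open>a\<close> and \<open>b\<close> are positive.\<close>

definition qprod :: "int \<Rightarrow> nat \<Rightarrow> nat \<Rightarrow> int fps" where
  "qprod s a b = Abs_fps (\<lambda>n. (\<Prod>k<Suc n. qfactor s (a * k + b)) $ n)"

lemma mult_qfactor_nth_less: "n < m \<Longrightarrow> (f * qfactor s m) $ n = f $ n"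
  by (simp add: qfactor_def distrib_left mult.left_commute[of f] fps_X_power_mult_right_nth)

lemma qfactor_minus_one: "qfactor (- 1) m = 1 - fps_X ^ m"
  by (rule fps_ext) (simp add: qfactor_def)

lemma qfactor_nth_0: "m > 0 \<Longrightarrow> qfactor s m $ 0 = 1"
  by (simp add: qfactor_def)

text \<open>For \<open>k \<ge> n\<close> the exponent \<open>a * k + b\<close> exceeds
  \<open>n\<close>, so that factor leaves the \<open>n\<close>-th coefficient alone.\<close>

lemma prod_qfactor_nth_stable:
  assumes "a > 0" "b > 0" "n \<le> M" "M \<le> N"
  shows "(\<Prod>k<N. qfactor s (a * k + b)) $ n = (\<Prod>k<M. qfactor s (a * k + b)) $ n"
  using assms(4)
proof (induction N rule: dec_induct)
  case (step N)
  have "N \<le> a * N" using assms(1) by simp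
  then have "n < a * N + b" using assms step(1) by linarith
  with step show ?case by (simp add: mult_qfactor_nth_less)
qed simp

lemma tendsto_qprod:
  assumes "a > 0" "b > 0"
  shows "(\<lambda>N. \<Prod>k<N. qfactor s (a * k + b)) \<longlonglongrightarrow> qprod s a b"
proof (rule tendsto_fpsI)
  fix n
  show "\<forall>\<^sub>F N in sequentially. (\<Prod>k<N. qfactor s (a * k + b)) $ n = qprod s a b $ n"
    using eventually_ge_at_top[of "Suc n"]
  proof eventually_elim
    case (elim N)
    then show ?case
      unfolding qprod_def fps_nth_Abs_fps by (intro prod_qfactor_nth_stable assms) auto
  qed
qed

lemma qprod_nth_0: "b > 0 \<Longrightarrow> qprod s a b $ 0 = 1"
  by (simp add: qprod_def qfactor_nth_0)

lemma qprod_nonzero: "b > 0 \<Longrightarrow> qprod s a b \<noteq> 0"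
  using qprod_nth_0[of b s a] by auto

lemma qfactor_mult_neg: "qfactor s m * qfactor (- s) m = qfactor (- (s\<^sup>2)) (2 * m)"
proof -
  have "(1 + c * x) * (1 + (- c) * x) = 1 + (- (c * c)) * (x * x)" for c x :: "int fps"
    by (simp add: ring_distribs mult.assoc mult.left_commute)
  from this[of "fps_const s" "fps_X ^ m"] show ?thesis
    unfolding qfactor_def mult_2 power_add power2_eq_square fps_const_neg fps_const_mult .
qed

text \<open>A difference of squares in each factor. This is what relates factors with a plus sign to
  factors with a minus sign.\<close>

lemma qprod_mult_neg:
  assumes "a > 0" "b > 0"
  shows "qprod s a b * qprod (- s) a b = qprod (- (s\<^sup>2)) (2 * a) (2 * b)"
proof (rule LIMSEQ_unique)
  show "(\<lambda>N. (\<Prod>k<N. qfactor s (a * k + b)) * (\<Prod>k<N. qfactor (- s) (a * k + b)))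
      \<longlonglongrightarrow> qprod s a b * qprod (- s) a b"
    by (intro tendsto_fps_mult tendsto_qprod assms)
  show "(\<lambda>N. (\<Prod>k<N. qfactor s (a * k + b)) * (\<Prod>k<N. qfactor (- s) (a * k + b)))
      \<longlonglongrightarrow> qprod (- (s\<^sup>2)) (2 * a) (2 * b)"
  proof -
    have "2 * a * k + 2 * b = 2 * (a * k + b)" for k by simp
    with tendsto_qprod[of "2 * a" "2 * b" "- (s\<^sup>2)"] assms show ?thesis
      unfolding prod.distrib[symmetric] qfactor_mult_neg by simp
  qed
qed

text \<open>The factors are sorted by the residue \<open>i\<close> of \<open>k\<close> modulo
  \<open>c\<close>: for \<open>k = c * m + i\<close> the exponent is
  \<open>c * a * m + (b + i * a)\<close>.\<close>

lemma qprod_split: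
  assumes "a > 0" "b > 0" "c > 0"
  shows "qprod s a b = (\<Prod>i<c. qprod s (c * a) (b + i * a))"
proof (rule LIMSEQ_unique)
  \<comment> \<open>Along multiples of \<open>c\<close> the partial products consist of complete
    blocks of residues.\<close>
  have "strict_mono (\<lambda>N. N * c)" using assms by (simp add: strict_mono_def)
  from LIMSEQ_subseq_LIMSEQ[OF tendsto_qprod[OF assms(1,2)] this, of s]
  show "(\<lambda>N. \<Prod>k<N * c. qfactor s (a * k + b)) \<longlonglongrightarrow> qprod s a b"
    by (simp add: o_def)
  have "(\<Prod>k<N * c. qfactor s (a * k + b)) = (\<Prod>i<c. \<Prod>k<N. qfactor s (c * a * k + (b + i * a)))" for N
  proof -
    have "(\<Prod>k<N * c. qfactor s (a * k + b)) = (\<Prod>m<N. \<Prod>k\<in>{m*c..<m*c+c}. qfactor s (a * k + b))"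
      by (rule prod.nat_group[symmetric])
    also have "\<dots> = (\<Prod>m<N. \<Prod>i<c. qfactor s (c * a * m + (b + i * a)))"
    proof (rule prod.cong[OF refl])
      fix m
      show "(\<Prod>k\<in>{m*c..<m*c+c}. qfactor s (a * k + b)) = (\<Prod>i<c. qfactor s (c * a * m + (b + i * a)))"
        using prod.shift_bounds_nat_ivl[of "\<lambda>k. qfactor s (a * k + b)" 0 "m*c" c]
        by (simp add: algebra_simps atLeast0LessThan)
    qed
    also have "\<dots> = (\<Prod>i<c. \<Prod>k<N. qfactor s (c * a * k + (b + i * a)))"
      by (rule prod.swap)
    finally show ?thesis .
  qed
  then show "(\<lambda>N. \<Prod>k<N * c. qfactor s (a * k + b)) \<longlonglongrightarrow> (\<Prod>i<c. qprod s (c * a) (b + i * a))"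
    using assms by (auto intro!: tendsto_fps_prod tendsto_qprod)
qed

section \<open>Gaussian binomials\<close>

text \<open>The \<open>q\<close>-Pascal rule serves as definition, because dividing by
  \<open>1 - q ^ i\<close> makes no sense in a general commutative ring.\<close>

fun gauss_binomial :: "'a::comm_ring_1 \<Rightarrow> nat \<Rightarrow> nat \<Rightarrow> 'a" where
  "gauss_binomial q n 0 = 1"
| "gauss_binomial q 0 (Suc k) = 0"
| "gauss_binomial q (Suc n) (Suc k) = gauss_binomial q n k + q ^ Suc k * gauss_binomial q n (Suc k)"

lemma gauss_binomial_eq_0: "n < k \<Longrightarrow> gauss_binomial q n k = 0"
  by (induction q n k rule: gauss_binomial.induct) auto

text \<open>The homogeneous \<open>q\<close>-binomial theorem. Taking off the factor
  \<open>k = 0\<close> leaves the same product with \<open>y * q\<close> for \<open>y\<close>, hence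
  the induction over arbitrary \<open>y\<close>; comparing powers of \<open>y\<close> gives the
  \<open>q\<close>-Pascal rule.\<close>

lemma gauss_binomial_theorem:
  fixes q y z :: "'a::comm_ring_1"
  shows "(\<Prod>k<n. z + y * q ^ k) = (\<Sum>k\<le>n. q ^ (k choose 2) * y ^ k * z ^ (n - k) * gauss_binomial q n k)"
proof (induction n arbitrary: y)
  case (Suc n)
  define B where "B = gauss_binomial q n"
  \<comment> \<open>The exponent \<open>Suc k choose 2\<close> includes the \<open>q ^ k\<close>
    that comes from \<open>(y * q) ^ k\<close>.\<close>
  define t where "t k = q ^ (Suc k choose 2) * y ^ k * z ^ (n - k) * B k" for k
  have ch: "Suc (Suc k) choose 2 = (Suc k choose 2) + Suc k" for k
    by (simp add: numeral_2_eq_2)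
  have "(\<Prod>k<Suc n. z + y * q ^ k) = (z + y) * (\<Prod>k<n. z + (y * q) * q ^ k)"
    unfolding prod.lessThan_Suc_shift by (simp add: mult.assoc)
  also have "(\<Prod>k<n. z + (y * q) * q ^ k) = (\<Sum>k\<le>n. t k)"
    unfolding Suc.IH t_def B_def
    by (intro sum.cong) (auto simp: power_mult_distrib power_add numeral_2_eq_2 algebra_simps)
  also have "(z + y) * (\<Sum>k\<le>n. t k) = (\<Sum>k\<le>n. z * t k) + (\<Sum>k\<le>n. y * t k)"
    by (simp only: distrib_right sum_distrib_left sum.distrib)
  also have "(\<Sum>k\<le>n. z * t k) = z * t 0 + (\<Sum>k\<le>n. z * t (Suc k))"
  proof -
    have "(\<Sum>k\<le>n. z * t k) = (\<Sum>k\<le>Suc n. z * t k)"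
      by (simp add: t_def B_def gauss_binomial_eq_0)
    also have "\<dots> = z * t 0 + (\<Sum>k\<le>n. z * t (Suc k))" by (rule sum.atMost_Suc_shift)
    finally show ?thesis .
  qed
  also have "z * t 0 + (\<Sum>k\<le>n. z * t (Suc k)) + (\<Sum>k\<le>n. y * t k)
     = z * t 0 + (\<Sum>k\<le>n. z * t (Suc k) + y * t k)" by (simp add: sum.distrib)
  also have "\<dots> = z * t 0 + (\<Sum>k\<le>n. q ^ (Suc k choose 2) * y ^ Suc k * z ^ (Suc n - Suc k) *
       gauss_binomial q (Suc n) (Suc k))"
  proof (intro arg_cong2[where f="(+)"] refl sum.cong)
    fix k assume "k \<in> {..n}"
    show "z * t (Suc k) + y * t k = q ^ (Suc k choose 2) * y ^ Suc k * z ^ (Suc n - Suc k) *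
       gauss_binomial q (Suc n) (Suc k)"
    \<comment> \<open>For \<open>k = n\<close> the subtraction \<open>n - Suc k\<close> is
      truncated, but there \<open>t (Suc k)\<close> vanishes.\<close>
    proof (cases "k = n")
      case True
      then show ?thesis by (simp add: t_def B_def gauss_binomial_eq_0 algebra_simps)
    next
      case False
      with \<open>k \<in> {..n}\<close> have "n - k = Suc (n - Suc k)" by auto
      then show ?thesis by (simp add: t_def B_def algebra_simps power_add ch)
    qed
  qed
  also have "\<dots> = (\<Sum>k\<le>Suc n. q ^ (k choose 2) * y ^ k * z ^ (Suc n - k) * gauss_binomial q (Suc n) k)"
    unfolding sum.atMost_Suc_shift by (simp add: t_def B_def binomial_eq_0)
  finally show ?case .
qed (simp add: binomial_eq_0)

text \<open>The quotient of \<open>q\<close>-factorials, cleared of denominators. In the induction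
  both terms of the Pascal rule become multiples of \<open>F n\<close>, and their cofactors add up
  to \<open>1 - q ^ Suc n\<close>.\<close>

lemma gauss_binomial_fact:
  fixes q :: "'a::comm_ring_1"
  assumes "k \<le> n"
  defines "F \<equiv> \<lambda>m. \<Prod>i<m. 1 - q ^ Suc i"
  shows "F k * F (n - k) * gauss_binomial q n k = F n"
  using assms(1)
proof (induction n arbitrary: k)
  case 0
  then show ?case by (simp add: F_def)
next
  case (Suc n)
  have FS: "F (Suc m) = F m * (1 - q ^ Suc m)" for m by (simp add: F_def)
  show ?case
  proof (cases k)
    case 0
    then show ?thesis by (simp add: F_def)
  next
    case (Suc j)
    with Suc.prems have "j \<le> n" by simp
    have 1: "F j * F (n - j) * gauss_binomial q n j = F n" by (rule Suc.IH) fact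
    have 2: "F (Suc j) * F (n - j) * gauss_binomial q n (Suc j) = F n * (1 - q ^ (n - j))"
    \<comment> \<open>At \<open>j = n\<close> both sides are 0, the right one because
      \<open>1 - q ^ 0 = 0\<close>.\<close>
    proof (cases "j = n")
      case True then show ?thesis by (simp add: gauss_binomial_eq_0)
    next
      case False
      with \<open>j \<le> n\<close> have *: "n - j = Suc (n - Suc j)" "Suc j \<le> n" by auto
      have "F (Suc j) * F (n - Suc j) * gauss_binomial q n (Suc j) = F n" by (rule Suc.IH) fact
      then have "F (Suc j) * F (n - Suc j) * gauss_binomial q n (Suc j) * (1 - q ^ (n - j)) = F n * (1 - q ^ (n - j))"
        by simp
      moreover have "F (n - j) = F (n - Suc j) * (1 - q ^ (n - j))"
        using FS[of "n - Suc j"] *(1) by simp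
      ultimately show ?thesis by (simp only: mult_ac)
    qed
    have "F k * F (Suc n - k) * gauss_binomial q (Suc n) k =
       F j * F (n - j) * gauss_binomial q n j * (1 - q ^ Suc j) +
       q ^ Suc j * (F (Suc j) * F (n - j) * gauss_binomial q n (Suc j))"
      unfolding Suc by (simp add: FS distrib_left distrib_right mult_ac)
    also have "\<dots> = F n * (1 - q ^ Suc j + q ^ Suc j * (1 - q ^ (n - j)))"
      unfolding 1 2 by (simp add: distrib_left mult_ac)
    also have "q ^ Suc j * (1 - q ^ (n - j)) = q ^ Suc j - q ^ Suc n"
      using \<open>j \<le> n\<close> power_add[of q "Suc j" "n - j"] by (simp add: right_diff_distrib)
    finally show ?thesis by (simp add: FS)
  qed
qed

section \<open>Weighted counting series\<close>

definition finite_fibres :: "'i set \<Rightarrow> ('i \<Rightarrow> nat) \<Rightarrow> bool" where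
  "finite_fibres I e \<longleftrightarrow> (\<forall>n. finite {i\<in>I. e i = n})"

text \<open>A coefficient with an infinite fibre is \<open>0\<close>, hence the assumption \<open>finite_fibres\<close> below.\<close>

definition gen_series :: "'i set \<Rightarrow> ('i \<Rightarrow> int) \<Rightarrow> ('i \<Rightarrow> nat) \<Rightarrow> int fps" where
  "gen_series I w e = Abs_fps (\<lambda>n. \<Sum>i | i \<in> I \<and> e i = n. w i)"

lemma gen_series_nth: "gen_series I w e $ n = (\<Sum>i | i \<in> I \<and> e i = n. w i)"
  by (simp add: gen_series_def)

lemma finite_fibres_le:
  assumes "finite_fibres I e"
  shows "finite {i\<in>I. e i \<le> n}"
proof -
  have "{i\<in>I. e i \<le> n} = (\<Union>m\<le>n. {i\<in>I. e i = m})" by auto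
  with assms show ?thesis by (simp add: finite_fibres_def)
qed

lemma finite_fibresI: "(\<And>n. finite {i\<in>I. e i \<le> n}) \<Longrightarrow> finite_fibres I e"
  unfolding finite_fibres_def by (metis (mono_tags, lifting) Collect_mono finite_subset order_refl)

lemma finite_fibres_intI:
  assumes "\<And>j::int. \<bar>j\<bar> \<le> int (e j)"
  shows "finite_fibres UNIV e"
proof (rule finite_fibresI)
  fix n
  have "{j \<in> UNIV. e j \<le> n} \<subseteq> {- int n..int n}"
  proof
    fix j assume "j \<in> {j \<in> UNIV. e j \<le> n}"
    then show "j \<in> {- int n..int n}"
      using assms[of j] by (simp add: abs_le_iff)
  qed
  then show "finite {j \<in> UNIV. e j \<le> n}"
    by (rule finite_subset) simp
qed

text \<open>Grouping the indices by the value of \<open>e\<close> gives the Cauchy product. With a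
  partition series for \<open>f\<close>, the right-hand side has the shape of the sums in the
  theorem.\<close>

lemma mult_gen_series_nth:
  assumes "finite_fibres I e"
  shows "(f * gen_series I w e) $ n = (\<Sum>i | i \<in> I \<and> e i \<le> n. f $ (n - e i) * w i)"
proof -
  have "(\<Sum>i | i \<in> I \<and> e i \<le> n. f $ (n - e i) * w i)
      = (\<Sum>m\<le>n. \<Sum>i | i \<in> {i \<in> I. e i \<le> n} \<and> e i = m. f $ (n - e i) * w i)"
    by (rule sum.group[symmetric]) (auto intro: finite_fibres_le assms)
  also have "\<dots> = (\<Sum>m\<le>n. f $ (n - m) * gen_series I w e $ m)"
    by (auto simp: gen_series_nth sum_distrib_left intro!: sum.cong)
  also have "\<dots> = (gen_series I w e * f) $ n"
    unfolding fps_mult_nth atLeast0AtMost by (intro sum.cong refl mult.commute)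
  finally show ?thesis by (simp add: mult.commute)
qed

lemma gen_series_mult:
  assumes "finite_fibres I e" "finite_fibres J d"
  shows "gen_series I w e * gen_series J v d =
    gen_series (I \<times> J) (\<lambda>(i, j). w i * v j) (\<lambda>(i, j). e i + d j)"
proof (rule fps_ext)
  fix n
  have "(gen_series I w e * gen_series J v d) $ n =
     (\<Sum>j | j \<in> J \<and> d j \<le> n. \<Sum>i | i \<in> I \<and> e i = n - d j. w i * v j)"
    by (simp add: mult_gen_series_nth assms gen_series_nth sum_distrib_right)
  also have "\<dots> = (\<Sum>(j, i) \<in> (SIGMA j:{j \<in> J. d j \<le> n}. {i \<in> I. e i = n - d j}). w i * v j)"
    using assms(1) by (intro sum.Sigma) (auto intro: finite_fibres_le[OF assms(2)] simp: finite_fibres_def)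
  also have "\<dots> = (\<Sum>(i, j) | i \<in> I \<and> j \<in> J \<and> e i + d j = n. w i * v j)"
    by (rule sum.reindex_bij_witness[of _ prod.swap prod.swap]) auto
  also have "\<dots> = gen_series (I \<times> J) (\<lambda>(i, j). w i * v j) (\<lambda>(i, j). e i + d j) $ n"
    by (auto simp: gen_series_nth intro!: sum.cong)
  finally show "(gen_series I w e * gen_series J v d) $ n = \<dots>" .
qed

lemma finite_fibres_times:
  assumes "finite_fibres I e" "finite_fibres J d"
  shows "finite_fibres (I \<times> J) (\<lambda>(i, j). e i + d j)"
proof (rule finite_fibresI)
  fix n
  have "finite ({i\<in>I. e i \<le> n} \<times> {j\<in>J. d j \<le> n})"
    using finite_fibres_le[OF assms(1)] finite_fibres_le[OF assms(2)] by blast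
  then show "finite {x \<in> I \<times> J. (case x of (i, j) \<Rightarrow> e i + d j) \<le> n}"
    by (rule finite_subset[rotated]) auto
qed

lemma gen_series_union:
  assumes "finite_fibres (I \<union> J) e" "I \<inter> J = {}"
  shows "gen_series (I \<union> J) w e = gen_series I w e + gen_series J w e"
proof (rule fps_ext)
  fix n
  have fin: "finite {i \<in> I \<union> J. e i = n}" using assms(1) by (simp add: finite_fibres_def)
  have eq: "{i \<in> I \<union> J. e i = n} = {i \<in> I. e i = n} \<union> {i \<in> J. e i = n}" by auto
  show "gen_series (I \<union> J) w e $ n = (gen_series I w e + gen_series J w e) $ n"
    using fin assms(2) unfolding gen_series_nth fps_add_nth eq
    by (intro sum.union_disjoint) auto
qed

lemma gen_series_reindex:
  assumes "bij_betw h J I"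
    and "\<And>j. j \<in> J \<Longrightarrow> w (h j) = v j" "\<And>j. j \<in> J \<Longrightarrow> e (h j) = d j"
  shows "gen_series I w e = gen_series J v d"
proof (rule fps_ext)
  fix n
  have "bij_betw h {j \<in> J. d j = n} {i \<in> I. e i = n}"
    using assms(1,3) by (auto simp: bij_betw_def inj_on_def image_iff)
  then have "(\<Sum>j | j \<in> J \<and> d j = n. w (h j)) = (\<Sum>i | i \<in> I \<and> e i = n. w i)"
    by (rule sum.reindex_bij_betw)
  then show "gen_series I w e $ n = gen_series J v d $ n"
    using assms(2) by (simp add: gen_series_nth)
qed

lemma gen_series_uminus: "gen_series I (\<lambda>i. - w i) e = - gen_series I w e"
  by (rule fps_ext) (simp add: gen_series_nth sum_negf)

text \<open>The series equals its own negative, and an integer with this property is 0.\<close>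

lemma gen_series_eq_0:
  assumes "bij_betw h I I" "\<And>i. i \<in> I \<Longrightarrow> w (h i) = - w i" "\<And>i. i \<in> I \<Longrightarrow> e (h i) = e i"
  shows "gen_series I w e = 0"
proof -
  have "gen_series I w e = gen_series I (\<lambda>i. - w i) e"
    using assms by (intro gen_series_reindex[of h])
  then have "\<And>n. gen_series I w e $ n = - (gen_series I w e $ n)"
    by (metis gen_series_uminus fps_neg_nth)
  then show ?thesis by (intro fps_ext) (simp add: eq_neg_iff_add_eq_0)
qed

lemma gen_series_shift: "gen_series I w (\<lambda>i. e i + c) = fps_X ^ c * gen_series I w e"
proof (rule fps_ext)
  fix n
  have "{i \<in> I. e i + c = n} = (if n < c then {} else {i \<in> I. e i = n - c})"
    by auto
  then show "gen_series I w (\<lambda>i. e i + c) $ n = (fps_X ^ c * gen_series I w e) $ n"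
    by (simp add: gen_series_nth fps_X_power_mult_nth)
qed

section \<open>The generating function of the partition numbers\<close>

definition partitions_above :: "nat \<Rightarrow> nat multiset set" where
  "partitions_above N = {M. \<forall>x\<in>#M. N < x}"

text \<open>The parameter \<open>N\<close> interpolates between \<open>P(q^c)\<close> at
  \<open>N = 0\<close> and the limit 1, so that the factors of Euler's product can be removed one at
  a time.\<close>

definition partition_series :: "nat \<Rightarrow> nat \<Rightarrow> int fps" where
  "partition_series c N = gen_series (partitions_above N) (\<lambda>_. 1) (\<lambda>M. c * sum_mset M)"

lemma finite_fibres_partitions:
  assumes "c > 0"
  shows "finite_fibres (partitions_above N) (\<lambda>M. c * sum_mset M)"
proof (rule finite_fibresI)
  fix n
  \<comment> \<open>As all parts are positive, the sum bounds both the size of each part and the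
    number of parts.\<close>
  have "{M \<in> partitions_above N. c * sum_mset M \<le> n} \<subseteq> mset ` {xs. set xs \<subseteq> {..n} \<and> length xs \<le> n}"
  proof
    fix M assume M: "M \<in> {M \<in> partitions_above N. c * sum_mset M \<le> n}"
    have "sum_mset M \<le> c * sum_mset M" using assms by simp
    also have "\<dots> \<le> n" using M by simp
    finally have le: "sum_mset M \<le> n" .
    obtain xs where xs: "M = mset xs" by (metis ex_mset)
    have "x \<le> n" if "x \<in> set xs" for x
      using member_le_sum_list[OF that] le xs by (simp add: sum_mset_sum_list)
    moreover have "length xs \<le> n"
    proof -
      have "length xs = sum_list (map (\<lambda>_. 1) xs)" by (simp add: sum_list_triv)
      also have "\<dots> \<le> sum_list (map (\<lambda>x. x) xs)"
        using M xs by (intro sum_list_mono) (force simp: partitions_above_def)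
      finally show ?thesis using le xs by (simp add: sum_mset_sum_list)
    qed
    ultimately show "M \<in> mset ` {xs. set xs \<subseteq> {..n} \<and> length xs \<le> n}"
      using xs by auto
  qed
  then show "finite {M \<in> partitions_above N. c * sum_mset M \<le> n}"
    by (rule finite_subset) (intro finite_imageI finite_lists_length_le, simp)
qed

text \<open>Deleting one part \<open>Suc N\<close> matches the partitions containing that part with
  all of \<open>partitions_above N\<close>. Multiplying by the factor therefore subtracts exactly
  those partitions.\<close>

lemma partition_series_step:
  assumes "c > 0"
  shows "partition_series c N * qfactor (-1) (c * N + c) = partition_series c (Suc N)"
proof -
  let ?e = "\<lambda>M. c * sum_mset M"
  let ?J = "add_mset (Suc N) ` partitions_above N"
  have un: "partitions_above N = partitions_above (Suc N) \<union> ?J"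
  proof (intro equalityI subsetI)
    fix M assume M: "M \<in> partitions_above N"
    show "M \<in> partitions_above (Suc N) \<union> ?J"
    proof (cases "Suc N \<in># M")
      case True
      then obtain M' where "M = add_mset (Suc N) M'" by (metis insert_DiffM)
      with M show ?thesis by (auto simp: partitions_above_def)
    next
      case False
      with M show ?thesis by (auto simp: partitions_above_def) (metis Suc_lessI)
    qed
  qed (auto simp: partitions_above_def)
  have disj: "partitions_above (Suc N) \<inter> ?J = {}" by (auto simp: partitions_above_def)
  have "partition_series c N = partition_series c (Suc N) + gen_series ?J (\<lambda>_. 1) ?e"
    unfolding partition_series_def using gen_series_union[of "partitions_above (Suc N)" ?J ?e]
      finite_fibres_partitions[OF assms] un disj by metis
  also have "gen_series ?J (\<lambda>_. 1) ?e = gen_series (partitions_above N) (\<lambda>_. 1) (\<lambda>M. ?e M + (c * N + c))"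
    by (rule gen_series_reindex[of "add_mset (Suc N)"]) (auto simp: bij_betw_def inj_on_def algebra_simps)
  also have "\<dots> = fps_X ^ (c * N + c) * partition_series c N"
    by (simp add: gen_series_shift partition_series_def)
  finally have "partition_series c N - fps_X ^ (c * N + c) * partition_series c N = partition_series c (Suc N)"
    by (simp only: diff_eq_eq)
  then show ?thesis
    by (simp add: qfactor_minus_one right_diff_distrib mult.commute)
qed

text \<open>Euler's product for the partition series. Each factor raises the lower bound on the
  parts by one, and with all parts above \<open>N \<ge> n\<close> only the empty partition has
  weight at most \<open>n\<close>.\<close>

lemma partition_series_mult_qprod:
  assumes "c > 0"
  shows "partition_series c 0 * qprod (-1) c c = 1"
proof (rule LIMSEQ_unique)
  show "(\<lambda>N. partition_series c 0 * (\<Prod>k<N. qfactor (-1) (c * k + c)))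
       \<longlonglongrightarrow> partition_series c 0 * qprod (-1) c c"
    using assms by (intro tendsto_fps_mult tendsto_qprod tendsto_const)
  have "partition_series c 0 * (\<Prod>k<N. qfactor (-1) (c * k + c)) = partition_series c N" for N
    by (induction N) (simp_all add: partition_series_step[OF assms] flip: mult.assoc)
  moreover have "partition_series c \<longlonglongrightarrow> 1"
  proof (rule tendsto_fpsI)
    fix n
    show "\<forall>\<^sub>F N in sequentially. partition_series c N $ n = 1 $ n"
      using eventually_ge_at_top[of n]
    proof eventually_elim
      case (elim N)
      have *: "M = {#}" if "M \<in> partitions_above N" "c * sum_mset M = n" for M
      proof (rule ccontr)
        assume "M \<noteq> {#}"
        then obtain x M' where M: "M = add_mset x M'" by (metis multiset_cases)
        have "sum_mset M \<le> c * sum_mset M" using assms by simp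
        with M that elim show False by (auto simp: partitions_above_def)
      qed
      have "{#} \<in> partitions_above N" by (simp add: partitions_above_def)
      then have "M \<in> partitions_above N \<and> c * sum_mset M = n \<longleftrightarrow> n = 0 \<and> M = {#}" for M
        using *[of M] by (cases "M = {#}") auto
      then show ?case by (simp add: partition_series_def gen_series_nth)
    qed
  qed
  ultimately show "(\<lambda>N. partition_series c 0 * (\<Prod>k<N. qfactor (-1) (c * k + c))) \<longlonglongrightarrow> 1"
    by simp
qed

lemma partition_series_nth:
  assumes "c > 0"
  shows "partition_series c 0 $ n = (if c dvd n then partition_count (int (n div c)) else 0)"
proof -
  have "{M. M \<in> partitions_above 0 \<and> c * sum_mset M = n} =
     (if c dvd n then {M. (\<forall>x\<in>#M. 0 < x) \<and> sum_mset M = n div c} else {})"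
    using assms by (auto simp: partitions_above_def)
  then show ?thesis
    by (simp add: partition_series_def gen_series_nth partition_count_def)
qed

section \<open>The Jacobi triple product\<close>

text \<open>The exponent of the bilateral series in the triple product with base \<open>q^a\<close>
  and parameter \<open>q^b\<close>. For \<open>0 < b < a\<close> the integer is nonnegative, so
  \<open>nat\<close> does not change its value.\<close>

definition theta_exp :: "nat \<Rightarrow> nat \<Rightarrow> int \<Rightarrow> nat" where
  "theta_exp a b j = nat (int a * (j * (j - 1) div 2) + int b * j)"

text \<open>For \<open>s * s = 1\<close> this is \<open>s ^ j\<close>, also at negative
  \<open>j\<close>.\<close>

definition theta_sign :: "int \<Rightarrow> int \<Rightarrow> int" where
  "theta_sign s j = (if even j then 1 else s)"

definition theta :: "int \<Rightarrow> nat \<Rightarrow> nat \<Rightarrow> int fps" where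
  "theta s a b = gen_series UNIV (theta_sign s) (theta_exp a b)"

text \<open>Provides at once that the exponents are nonnegative and that their fibres are
  finite.\<close>

lemma theta_exp_bound:
  assumes "0 < b" "b < a"
  shows "\<bar>j\<bar> \<le> int a * (j * (j - 1) div 2) + int b * j"
proof -
  have "2 * \<bar>j\<bar> \<le> int a * (j * (j - 1)) + 2 * (int b * j)"
  proof (cases "j \<ge> 1")
    case True
    then have "0 \<le> int a * (j * (j - 1))" by simp
    moreover have "1 * j \<le> int b * j" using assms True by (intro mult_right_mono) auto
    ultimately show ?thesis using True by linarith
  next
    case False
    define m where "m = - j"
    have m: "m \<ge> 0" using False by (simp add: m_def)
    show ?thesis
    proof (cases "m = 0")
      case True then show ?thesis by (simp add: m_def)
    next
      case False
      \<comment> \<open>For \<open>j = - m\<close> the claim is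
        \<open>m * 2 \<le> m * (a * (m + 1) - 2 * b)\<close>; since \<open>a \<ge> b + 1\<close> and
        \<open>m \<ge> 1\<close>, the bracket is at least 2.\<close>
      have "(int b + 1) * (m + 1) \<le> int a * (m + 1)"
        using assms m by (intro mult_right_mono) auto
      moreover have "int b * 1 \<le> int b * m" using False m by (intro mult_left_mono) auto
      ultimately have "2 \<le> int a * (m + 1) - 2 * int b" using False m by (simp add: algebra_simps)
      then have "m * 2 \<le> m * (int a * (m + 1) - 2 * int b)" using m by (rule mult_left_mono)
      then show ?thesis using m by (simp add: m_def algebra_simps)
    qed
  qed
  moreover have "int a * (j * (j - 1)) = 2 * (int a * (j * (j - 1) div 2))"
    by simp
  ultimately show ?thesis by linarith
qed

lemma int_theta_exp:
  assumes "0 < b" "b < a"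
  shows "2 * int (theta_exp a b j) = int a * (j * (j - 1)) + 2 * int b * j"
proof -
  have "2 * (int a * (j * (j - 1) div 2) + int b * j) = int a * (j * (j - 1)) + 2 * int b * j"
    by simp
  moreover have "int (theta_exp a b j) = int a * (j * (j - 1) div 2) + int b * j"
    unfolding theta_exp_def using theta_exp_bound[OF assms, of j] by linarith
  ultimately show ?thesis by simp
qed

lemma abs_le_theta_exp:
  assumes "0 < b" "b < a"
  shows "\<bar>j\<bar> \<le> int (theta_exp a b j)"
  unfolding theta_exp_def using theta_exp_bound[OF assms, of j] by linarith

lemma finite_fibres_theta: "0 < b \<Longrightarrow> b < a \<Longrightarrow> finite_fibres UNIV (theta_exp a b)"
  by (intro finite_fibres_intI abs_le_theta_exp)

section \<open>The finite form of the triple product\<close>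

lemma two_times_choose_two: "2 * int (k choose 2) = int k * (int k - 1)"
proof (cases k)
  case (Suc m)
  have "even (k * (k - 1))" using Suc by simp
  then have "2 * (k choose 2) = k * (k - 1)" unfolding choose_two by (rule dvd_mult_div_cancel)
  then have "2 * int (k choose 2) = int (k * (k - 1))" by linarith
  then show ?thesis using Suc by (simp add: algebra_simps)
qed (simp add: binomial_eq_0)

text \<open>Centring the quadratic exponent of the \<open>k\<close>-th \<open>q\<close>-binomial
  term at \<open>k = N\<close> leaves a constant and the theta exponent of
  \<open>j = k - N\<close>.\<close>

lemma theta_exp_choose:
  assumes "0 < b" "b < a" "k \<le> 2 * N"
  shows "a * (k choose 2) + b * k + a * N * (2 * N - k)
    = b * N + a * (N choose 2) + a * N * N + theta_exp a b (int k - int N)"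
proof -
  have c: "int a * (2 * int (m choose 2)) = int a * (int m * (int m - 1))" for m
    by (simp only: two_times_choose_two)
  obtain m where m: "2 * N - k = m" "int m = 2 * int N - int k" using assms(3) by auto
  have "2 * int (a * (k choose 2) + b * k + a * N * m) =
      2 * int (b * N + a * (N choose 2) + a * N * N + theta_exp a b (int k - int N))"
    using c[of k] c[of N] int_theta_exp[OF assms(1,2), of "int k - int N"]
    by (simp add: m(2) algebra_simps)
  then show ?thesis unfolding m(1) by (simp only: mult_cancel_left of_nat_eq_iff) simp
qed

lemma prod_const_X_power:
  "(\<Prod>k<N. fps_const s * fps_X ^ (a * k + b)) = fps_const (s ^ N) * (fps_X ^ (b * N + a * (N choose 2)) :: int fps)"
proof (induction N)
  case (Suc N)
  have "b * Suc N + a * (Suc N choose 2) = (b * N + a * (N choose 2)) + (a * N + b)"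
    by (simp add: numeral_2_eq_2 algebra_simps)
  then show ?case
    unfolding prod.lessThan_Suc Suc.IH by (simp only: power_add power_Suc fps_const_mult[symmetric] mult_ac)
qed (simp add: binomial_eq_0)

text \<open>This is the \<open>q\<close>-binomial theorem with \<open>2 N\<close> factors \<open>z + y q^k\<close>, where \<open>q = X^a\<close>,
  \<open>y = s X^b\<close> and \<open>z = X^(a N)\<close>: taking \<open>z\<close> instead of \<open>1\<close> avoids negative powers of \<open>X\<close>.\<close>

lemma finite_jacobi_triple_product:
  assumes "0 < b" "b < a" and s: "s * s = (1::int)"
  shows "(\<Prod>k<N. qfactor s (a * k + b)) * (\<Prod>k<N. qfactor s (a * k + (a - b))) =
    (\<Sum>k\<le>2 * N. fps_const (theta_sign s (int k - int N)) * fps_X ^ theta_exp a b (int k - int N) *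
       gauss_binomial (fps_X ^ a) (2 * N) k)"
proof -
  \<comment> \<open>The product of the \<open>h k\<close> is evaluated twice. The monomial
    \<open>Y\<close> comes out of both evaluations and is finally cancelled, as it is
    nonzero.\<close>
  define C where "C = b * N + a * (N choose 2) + a * N * N"
  define Y :: "int fps" where "Y = fps_const (s ^ N) * fps_X ^ C"
  define h :: "nat \<Rightarrow> int fps" where
    "h k = fps_X ^ (a * N) + (fps_const s * fps_X ^ b) * (fps_X ^ a) ^ k" for k
  \<comment> \<open>For \<open>k < N\<close> the smaller exponent is \<open>a * k + b\<close>, and
    pulling out \<open>s X^(a k + b)\<close> leaves \<open>1 + s X^(a N - a k - b)\<close> by
    \<open>s * s = 1\<close>. For the upper half \<open>X^(a N)\<close> is pulled out
    instead.\<close>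
  have lower: "h k = fps_const s * fps_X ^ (a * k + b) * qfactor s (a * (N - Suc k) + (a - b))" if "k < N" for k
  proof -
    from that obtain m where m: "N = Suc (k + m)" using less_iff_Suc_add by blast
    have "a * k + b + (a * (N - Suc k) + (a - b)) = a * N"
      using assms(2) by (simp add: m algebra_simps)
    then have split: "fps_X ^ (a * N) = (fps_X ^ (a * k + b) * fps_X ^ (a * (N - Suc k) + (a - b)) :: int fps)"
      by (simp only: power_add[symmetric])
    have ss: "fps_const s * fps_const s = 1" using s by simp
    have key: "x * z + c * x = c * x * (1 + c * z)" if "c * c = 1" for c x z :: "int fps"
    proof -
      have "c * x * (1 + c * z) = c * x + (c * c) * (x * z)" by (simp add: distrib_left mult_ac)
      then show ?thesis using that by (simp add: add.commute)
    qed
    have hk: "h k = fps_X ^ (a * N) + fps_const s * fps_X ^ (a * k + b)"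
      unfolding h_def power_add power_mult by (simp only: mult_ac)
    show ?thesis
      unfolding hk split qfactor_def by (rule key[OF ss])
  qed
  have upper: "h (k + N) = fps_X ^ (a * N) * qfactor s (a * k + b)" for k
    unfolding h_def qfactor_def power_add power_mult distrib_left mult_1_right by (simp only: mult_ac)
  have "(\<Prod>k<2 * N. h k) = (\<Prod>k<N. h k) * (\<Prod>k<N. h (k + N))"
  proof -
    have "prod h {0..<N} * prod h {N..<N + N} = prod h {0..<N + N}"
      by (rule prod.atLeastLessThan_concat) auto
    moreover have "prod h {0 + N..<N + N} = (\<Prod>k\<in>{0..<N}. h (k + N))"
      by (rule prod.shift_bounds_nat_ivl)
    ultimately show ?thesis
      unfolding mult_2 atLeast0LessThan add_0 by metis
  qed
  also have "(\<Prod>k<N. h k) = (\<Prod>k<N. fps_const s * fps_X ^ (a * k + b)) *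
      (\<Prod>k<N. qfactor s (a * (N - Suc k) + (a - b)))"
    unfolding prod.distrib[symmetric] by (rule prod.cong[OF refl], rule lower) simp
  also have "(\<Prod>k<N. qfactor s (a * (N - Suc k) + (a - b))) = (\<Prod>k<N. qfactor s (a * k + (a - b)))"
    by (rule prod.nat_diff_reindex)
  also have "(\<Prod>k<N. h (k + N)) = fps_X ^ (a * N * N) * (\<Prod>k<N. qfactor s (a * k + b))"
    by (simp only: upper prod.distrib prod_constant card_lessThan power_mult)
  finally have eq1: "(\<Prod>k<2 * N. h k) = Y * ((\<Prod>k<N. qfactor s (a * k + b)) * (\<Prod>k<N. qfactor s (a * k + (a - b))))"
    unfolding prod_const_X_power Y_def C_def by (simp only: power_add mult_ac)
  have eq2: "(\<Prod>k<2 * N. h k) = Y * (\<Sum>k\<le>2 * N. fps_const (theta_sign s (int k - int N)) *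
       fps_X ^ theta_exp a b (int k - int N) * gauss_binomial (fps_X ^ a) (2 * N) k)"
    unfolding h_def gauss_binomial_theorem sum_distrib_left
  proof (rule sum.cong[OF refl])
    fix k assume k: "k \<in> {..2 * N}"
    let ?G = "gauss_binomial (fps_X ^ a) (2 * N) k :: int fps"
    let ?t = "theta_sign s (int k - int N)" and ?x = "fps_X ^ theta_exp a b (int k - int N) :: int fps"
    have sq: "s ^ m = (if even m then 1 else s)" for m
      by (induction m) (simp_all add: s)
    have sgn: "s ^ k = s ^ N * ?t"
    proof (cases "even k = even N")
      case True
      then show ?thesis unfolding sq[of k] sq[of N] theta_sign_def by auto
    next
      case False
      then show ?thesis unfolding sq[of k] sq[of N] theta_sign_def by (auto simp: s)
    qed
    have expo: "(fps_X ^ a) ^ (k choose 2) * fps_X ^ (b * k) * (fps_X ^ (a * N)) ^ (2 * N - k) = fps_X ^ C * ?x"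
      unfolding power_mult[symmetric] power_add[symmetric] C_def
      by (rule arg_cong[where f = "power fps_X"], rule theta_exp_choose) (use assms k in auto)
    have "(fps_X ^ a) ^ (k choose 2) * (fps_const s * fps_X ^ b) ^ k * (fps_X ^ (a * N)) ^ (2 * N - k) * ?G
      = fps_const (s ^ k) * ((fps_X ^ a) ^ (k choose 2) * fps_X ^ (b * k) * (fps_X ^ (a * N)) ^ (2 * N - k)) * ?G"
      by (simp only: power_mult_distrib power_mult fps_const_power mult_ac)
    also have "\<dots> = Y * (fps_const ?t * ?x * ?G)"
      unfolding sgn expo Y_def fps_const_mult[symmetric] by (simp only: mult_ac)
    finally show "(fps_X ^ a) ^ (k choose 2) * (fps_const s * fps_X ^ b) ^ k * (fps_X ^ (a * N)) ^ (2 * N - k) * ?G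
      = Y * (fps_const ?t * ?x * ?G)" .
  qed
  have Y0: "Y \<noteq> 0"
  proof -
    have "s \<noteq> 0" using s by auto
    then show ?thesis by (simp add: Y_def)
  qed
  show ?thesis
    by (rule iffD1[OF mult_left_cancel[OF Y0] trans[OF sym[OF eq1] eq2]])
qed

section \<open>The limit of the finite triple product\<close>

lemma fps_mult_nth_cong:
  assumes "\<And>i. i \<le> n \<Longrightarrow> f $ i = f' $ i" "\<And>i. i \<le> n \<Longrightarrow> g $ i = g' $ i"
  shows "(f * g) $ n = (f' * g' :: 'a::comm_ring_1 fps) $ n"
  using assms by (auto simp: fps_mult_nth intro!: sum.cong)

text \<open>Cancellation when equality is known only up to degree \<open>n\<close>: since
  \<open>f $ 0\<close> is nonzero, \<open>f * (g - h)\<close> has the same lowest degree as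
  \<open>g - h\<close>.\<close>

lemma fps_mult_nth_cancel:
  fixes f g h :: "'a::idom fps"
  assumes "f $ 0 \<noteq> 0" "\<And>i. i \<le> n \<Longrightarrow> (f * g) $ i = (f * h) $ i"
  shows "g $ n = h $ n"
proof (rule ccontr)
  assume *: "g $ n \<noteq> h $ n"
  then have d: "g - h \<noteq> 0" by auto
  have le: "subdegree (g - h) \<le> n" using * by (intro subdegree_leI) simp
  have "f \<noteq> 0" "subdegree f = 0" using assms(1) by auto
  then have "subdegree (f * (g - h)) = subdegree (g - h)" "f * (g - h) \<noteq> 0" using d by auto
  then have "(f * (g - h)) $ subdegree (g - h) \<noteq> 0" by (metis nth_subdegree_nonzero)
  with assms(2)[OF le] show False by (simp add: right_diff_distrib)
qed

text \<open>Here \<open>k\<close> and \<open>2 * N - k\<close> are at least \<open>n\<close>, so up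
  to degree \<open>n\<close> all \<open>q\<close>-factorials in \<open>gauss_binomial_fact\<close>
  agree with \<open>F N\<close>; cancelling one of them gives the claim.\<close>

lemma central_gauss_binomial_nth:
  assumes "a > 0" "2 * n \<le> N" "\<bar>int k - int N\<bar> \<le> int n" "m \<le> n"
  shows "((\<Prod>i<N. qfactor (-1) (a * i + a)) * gauss_binomial (fps_X ^ a) (2 * N) k) $ m = 1 $ m"
proof -
  define F where "F m = (\<Prod>i<m. qfactor (-1) (a * i + a))" for m
  have F: "F m = (\<Prod>i<m. 1 - (fps_X ^ a) ^ Suc i)" for m
    unfolding F_def by (simp add: qfactor_minus_one add.commute del: power_Suc flip: power_mult)
  let ?G = "gauss_binomial (fps_X ^ a) (2 * N) k :: int fps"
  have st: "F m $ i = F N $ i" if "i \<le> n" "n \<le> m" for m i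
  proof -
    have "F m $ i = F n $ i" "F N $ i = F n $ i"
      unfolding F_def using that assms by (intro prod_qfactor_nth_stable; simp)+
    then show ?thesis by simp
  qed
  have k: "n \<le> k" "n \<le> 2 * N - k" "k \<le> 2 * N" using assms by linarith+
  have eq: "(F N * (F N * ?G)) $ i = (F N * 1) $ i" if i: "i \<le> n" for i
  proof -
    have "(F N * F N) $ j = (F k * F (2 * N - k)) $ j" if "j \<le> n" for j
      by (intro fps_mult_nth_cong st[symmetric]) (use k that in simp_all)
    then have "((F N * F N) * ?G) $ i = ((F k * F (2 * N - k)) * ?G) $ i"
      by (rule fps_mult_nth_cong) (use i in auto)
    also have "(F k * F (2 * N - k)) * ?G = F (2 * N)"
      using gauss_binomial_fact[OF k(3), of "fps_X ^ a :: int fps"] unfolding F .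
    also have "F (2 * N) $ i = F N $ i" using i assms by (intro st) auto
    finally show ?thesis by (simp add: mult.assoc)
  qed
  have F0: "F N $ 0 = 1"
    unfolding F_def by (subst prod_qfactor_nth_stable[of a a 0 0 N]) (use assms in simp_all)
  have "(F N * ?G) $ m = 1 $ m"
    by (rule fps_mult_nth_cancel[of "F N"], unfold F0, simp, rule eq) (use assms(4) in linarith)
  then show ?thesis unfolding F_def .
qed

text \<open>In the finite form times \<open>(q^a; q^a)\<close>, only terms with
  \<open>\<bar>k - N\<bar> \<le> n\<close> reach the \<open>n\<close>-th coefficient, and for these
  the Gaussian binomial acts as the inverse of that product.\<close>

lemma jacobi_triple_product:
  assumes "0 < b" "b < a" and s: "s * s = 1"
  shows "qprod (-1) a a * (qprod s a b * qprod s a (a - b)) = theta s a b"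
proof (rule LIMSEQ_unique)
  let ?P = "\<lambda>N. (\<Prod>k<N. qfactor (-1) (a * k + a)) *
    ((\<Prod>k<N. qfactor s (a * k + b)) * (\<Prod>k<N. qfactor s (a * k + (a - b))))"
  show "?P \<longlonglongrightarrow> qprod (-1) a a * (qprod s a b * qprod s a (a - b))"
    using assms by (intro tendsto_fps_mult tendsto_qprod) auto
  show "?P \<longlonglongrightarrow> theta s a b"
  proof (rule tendsto_fpsI)
    fix n
    show "\<forall>\<^sub>F N in sequentially. ?P N $ n = theta s a b $ n"
      using eventually_ge_at_top[of "2 * n"]
    proof eventually_elim
      case (elim N)
      define e where "e k = theta_exp a b (int k - int N)" for k
      define c where "c k = theta_sign s (int k - int N)" for k
      define G where "G k = (\<Prod>i<N. qfactor (-1) (a * i + a)) * gauss_binomial (fps_X ^ a) (2 * N) k" for k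
      have "?P N = (\<Sum>k\<le>2 * N. fps_const (c k) * (fps_X ^ e k * G k))"
        unfolding finite_jacobi_triple_product[OF assms] sum_distrib_left c_def e_def G_def
        by (simp only: mult_ac)
      then have "?P N $ n = (\<Sum>k\<le>2 * N. c k * (fps_X ^ e k * G k) $ n)"
        by (simp add: fps_sum_nth)
      also have "\<dots> = (\<Sum>k\<le>2 * N. if e k = n then c k else 0)"
      proof (rule sum.cong[OF refl])
        fix k
        \<comment> \<open>Up to degree \<open>n\<close>, \<open>G k\<close> is 1, so the
          \<open>k\<close>-th term contributes only if its exponent is exactly
          \<open>n\<close>.\<close>
        have "G k $ (n - e k) = 1 $ (n - e k)" if "e k \<le> n"
          unfolding G_def
        proof (rule central_gauss_binomial_nth)
          show "\<bar>int k - int N\<bar> \<le> int n"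
            using abs_le_theta_exp[OF assms(1,2), of "int k - int N"] that by (simp add: e_def)
        qed (use assms elim in auto)
        then show "c k * (fps_X ^ e k * G k) $ n = (if e k = n then c k else 0)"
          by (auto simp: fps_X_power_mult_nth)
      qed
      also have "\<dots> = (\<Sum>k | k \<in> {..2 * N} \<and> e k = n. c k)"
        by (rule sum.inter_filter[symmetric]) simp
      also have "\<dots> = (\<Sum>j | j \<in> UNIV \<and> theta_exp a b j = n. theta_sign s j)"
        unfolding c_def e_def
      proof (rule sum.reindex_bij_witness[of _ "\<lambda>j. nat (j + int N)" "\<lambda>k. int k - int N"])
        fix j assume "j \<in> {j. j \<in> UNIV \<and> theta_exp a b j = n}"
        then have "\<bar>j\<bar> \<le> int n" using abs_le_theta_exp[OF assms(1,2), of j] by simp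
        with elim have *: "0 \<le> j + int N" "nat (j + int N) \<le> 2 * N" by linarith+
        show "int (nat (j + int N)) - int N = j" using * by simp
        with * \<open>j \<in> _\<close> show "nat (j + int N) \<in> {k \<in> {..2 * N}. theta_exp a b (int k - int N) = n}"
          by simp
      qed auto
      finally show ?case by (simp add: theta_def gen_series_nth)
    qed
  qed
qed

section \<open>The quintuple product\<close>

lemma theta_sign_add: "theta_sign (- 1) (j + k) = theta_sign (- 1) j * theta_sign (- 1) k"
  and theta_sign_diff: "theta_sign (- 1) (j - k) = theta_sign (- 1) j * theta_sign (- 1) k"
  by (auto simp: theta_sign_def)

lemma int_theta_exp_10_7: "int (theta_exp 10 7 m) = 5 * m\<^sup>2 + 2 * m"
  using int_theta_exp[of 7 10 m] by (simp add: power2_eq_square algebra_simps)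

lemma int_theta_exp_20_4: "int (theta_exp 20 4 m) = 10 * m\<^sup>2 - 6 * m"
  using int_theta_exp[of 4 20 m] by (simp add: power2_eq_square algebra_simps)

lemma int_theta_exp_60_20: "int (theta_exp 60 20 m) = 30 * m\<^sup>2 - 10 * m"
  using int_theta_exp[of 20 60 m] by (simp add: power2_eq_square algebra_simps)

definition exp_r :: "int \<Rightarrow> nat" where "exp_r k = nat (15 * k\<^sup>2 - 4 * k)"
definition exp_s :: "int \<Rightarrow> nat" where "exp_s k = nat (15 * k\<^sup>2 - 14 * k + 3)"

lemma abs_le_square: "\<bar>k\<bar> \<le> k\<^sup>2" for k :: int
proof (cases "k = 0")
  case False
  then have "\<bar>k\<bar> * 1 \<le> \<bar>k\<bar> * \<bar>k\<bar>" by (intro mult_left_mono) auto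
  then show ?thesis by (simp add: power2_eq_square)
qed simp

lemma abs_le_exp_r: "\<bar>k\<bar> \<le> 15 * k\<^sup>2 - 4 * k"
  and abs_le_exp_s: "\<bar>k\<bar> \<le> 15 * k\<^sup>2 - 14 * k + 3" for k :: int
  using abs_le_square[of k] by linarith+

lemma int_exp_r: "int (exp_r k) = 15 * k\<^sup>2 - 4 * k"
  and int_exp_s: "int (exp_s k) = 15 * k\<^sup>2 - 14 * k + 3"
  unfolding exp_r_def exp_s_def using abs_le_exp_r[of k] abs_le_exp_s[of k] by linarith+

lemma finite_fibres_exp_r: "finite_fibres UNIV exp_r"
  and finite_fibres_exp_s: "finite_fibres UNIV exp_s"
  by (intro finite_fibres_intI; simp add: int_exp_r int_exp_s abs_le_exp_r abs_le_exp_s)+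

definition quintuple :: "int fps" where
  "quintuple = gen_series UNIV (theta_sign (- 1)) exp_r + gen_series UNIV (theta_sign (- 1)) exp_s"

text \<open>With \<open>u = m + 2 n\<close> and \<open>v = m - n\<close> the exponent becomes
  \<open>(5 u^2 - 4 u + 10 (v^2 + v)) / 3\<close>, without mixed term. Hence each class of
  \<open>v\<close> modulo 3 can be treated by a linear substitution.\<close>

lemma quintuple_product: "theta 1 10 7 * theta (- 1) 20 4 = quintuple * theta (- 1) 60 20"
proof -
  define w where "w = (\<lambda>(m::int, n). theta_sign (- 1) n)"
  define e where "e = (\<lambda>(m, n). theta_exp 10 7 m + theta_exp 20 4 n)"
  \<comment> \<open>Index the double sum by the class of \<open>m - n\<close> modulo 3: class 1 cancels under the involution
    that flips the parity of \<open>n\<close> and fixes \<open>m + 2n\<close>.\<close>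
  define R where "R r = {(m::int, n::int). (m - n) mod 3 = r}" for r
  have int_e: "int (e (m, n)) = 5 * m\<^sup>2 + 2 * m + 10 * n\<^sup>2 - 6 * n" for m n
    by (simp add: e_def int_theta_exp_10_7 int_theta_exp_20_4)
  have fin: "finite_fibres (UNIV \<times> UNIV) e"
    unfolding e_def by (intro finite_fibres_times finite_fibres_theta) auto
  have fin': "finite_fibres A e" for A
    using fin by (auto simp: finite_fibres_def intro: rev_finite_subset)
  have UN: "UNIV \<times> UNIV = R 0 \<union> (R 1 \<union> R 2)"
  proof -
    have "(m - n) mod 3 = 0 \<or> (m - n) mod 3 = 1 \<or> (m - n) mod 3 = 2" for m n :: int
      by presburger
    then show ?thesis by (auto simp: R_def)
  qed
  have "theta 1 10 7 * theta (- 1) 20 4 = gen_series (UNIV \<times> UNIV)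
    (\<lambda>(m, n). theta_sign 1 m * theta_sign (- 1) n) (\<lambda>(m, n). theta_exp 10 7 m + theta_exp 20 4 n)"
    unfolding theta_def by (intro gen_series_mult finite_fibres_theta) auto
  also have "\<dots> = gen_series (UNIV \<times> UNIV) w e"
    unfolding w_def e_def by (simp add: theta_sign_def[of 1])
  also have "\<dots> = gen_series (R 0) w e + (gen_series (R 1) w e + gen_series (R 2) w e)"
    unfolding UN by (subst gen_series_union; (subst gen_series_union)?; (rule fin')?) (auto simp: R_def)
  also have "gen_series (R 0) w e = gen_series (UNIV \<times> UNIV)
    (\<lambda>(k, t). theta_sign (- 1) k * theta_sign (- 1) t) (\<lambda>(k, t). exp_r k + theta_exp 60 20 t)"
  \<comment> \<open>This is \<open>u = 3 k\<close>, \<open>v = - 3 t\<close>.\<close>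
  proof (rule gen_series_reindex[of "\<lambda>(k, t). (k - 2 * t, k + t)"])
    show "bij_betw (\<lambda>(k, t). (k - 2 * t, k + t)) (UNIV \<times> UNIV) (R 0)"
    proof (rule bij_betw_byWitness[where f' = "\<lambda>(m, n). (n - (n - m) div 3, (n - m) div 3)"])
      have "n - m = 3 * ((n - m) div 3)" if "(m - n) mod 3 = 0" for m n :: int
        using that by presburger
      then show "\<forall>x\<in>R 0. (case case x of (m, n) \<Rightarrow> (n - (n - m) div 3, (n - m) div 3) of
          (k, t) \<Rightarrow> (k - 2 * t, k + t)) = x"
        by (fastforce simp: R_def)
    qed (auto simp: R_def)
    fix x :: "int \<times> int"
    obtain k t where x: "x = (k, t)" by fastforce
    show "w (case x of (k, t) \<Rightarrow> (k - 2 * t, k + t)) = (case x of (k, t) \<Rightarrow> theta_sign (- 1) k * theta_sign (- 1) t)"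
      by (simp add: x w_def theta_sign_add)
    have "int (e (k - 2 * t, k + t)) = int (exp_r k + theta_exp 60 20 t)"
      unfolding int_e of_nat_add int_exp_r int_theta_exp_60_20 by (simp add: power2_eq_square algebra_simps)
    then show "e (case x of (k, t) \<Rightarrow> (k - 2 * t, k + t)) = (case x of (k, t) \<Rightarrow> exp_r k + theta_exp 60 20 t)"
      by (simp only: x prod.case of_nat_eq_iff)
  qed
  also have "gen_series (R 2) w e = gen_series (UNIV \<times> UNIV)
    (\<lambda>(k, t). theta_sign (- 1) k * theta_sign (- 1) t) (\<lambda>(k, t). exp_s k + theta_exp 60 20 t)"
  \<comment> \<open>This is \<open>u = 3 k - 1\<close>, \<open>v = 3 t - 1\<close>.\<close>
  proof (rule gen_series_reindex[of "\<lambda>(k, t). (k - 1 + 2 * t, k - t)"])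
    show "bij_betw (\<lambda>(k, t). (k - 1 + 2 * t, k - t)) (UNIV \<times> UNIV) (R 2)"
    proof (rule bij_betw_byWitness[where f' = "\<lambda>(m, n). (n + (m - n + 1) div 3, (m - n + 1) div 3)"])
      have "m - n + 1 = 3 * ((m - n + 1) div 3)" if "(m - n) mod 3 = 2" for m n :: int
        using that by presburger
      then show "\<forall>x\<in>R 2. (case case x of (m, n) \<Rightarrow> (n + (m - n + 1) div 3, (m - n + 1) div 3) of
          (k, t) \<Rightarrow> (k - 1 + 2 * t, k - t)) = x"
        by (fastforce simp: R_def)
      have "(k - 1 + 2 * t - (k - t)) mod 3 = 2" for k t :: int
        by presburger
      then show "(\<lambda>(k, t). (k - 1 + 2 * t, k - t)) ` (UNIV \<times> UNIV) \<subseteq> R 2"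
        by (auto simp: R_def)
    qed auto
    fix x :: "int \<times> int"
    obtain k t where x: "x = (k, t)" by fastforce
    show "w (case x of (k, t) \<Rightarrow> (k - 1 + 2 * t, k - t)) = (case x of (k, t) \<Rightarrow> theta_sign (- 1) k * theta_sign (- 1) t)"
      by (simp add: x w_def theta_sign_diff)
    have "int (e (k - 1 + 2 * t, k - t)) = int (exp_s k + theta_exp 60 20 t)"
      unfolding int_e of_nat_add int_exp_s int_theta_exp_60_20 by (simp add: power2_eq_square algebra_simps)
    then show "e (case x of (k, t) \<Rightarrow> (k - 1 + 2 * t, k - t)) = (case x of (k, t) \<Rightarrow> exp_s k + theta_exp 60 20 t)"
      by (simp only: x prod.case of_nat_eq_iff)
  qed
  also have "gen_series (R 1) w e = gen_series (UNIV \<times> UNIV) (\<lambda>(n, d). theta_sign (- 1) n) (\<lambda>(n, d). e (n + 1 + 3 * d, n))"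
  proof (rule gen_series_reindex[of "\<lambda>(n, d). (n + 1 + 3 * d, n)"])
    show "bij_betw (\<lambda>(n, d). (n + 1 + 3 * d, n)) (UNIV \<times> UNIV) (R 1)"
    proof (rule bij_betw_byWitness[where f' = "\<lambda>(m, n). (n, (m - n - 1) div 3)"])
      have "m - n - 1 = 3 * ((m - n - 1) div 3)" if "(m - n) mod 3 = 1" for m n :: int
        using that by presburger
      then show "\<forall>x\<in>R 1. (case case x of (m, n) \<Rightarrow> (n, (m - n - 1) div 3) of
          (n, d) \<Rightarrow> (n + 1 + 3 * d, n)) = x"
        by (fastforce simp: R_def)
      have "(n + 1 + 3 * d - n) mod 3 = 1" for n d :: int
        by presburger
      then show "(\<lambda>(n, d). (n + 1 + 3 * d, n)) ` (UNIV \<times> UNIV) \<subseteq> R 1"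
        by (auto simp: R_def)
    qed auto
  qed (auto simp: w_def)
  also have "\<dots> = 0"
  \<comment> \<open>With \<open>v = 1 + 3 d\<close> the map keeps \<open>u\<close> and sends
    \<open>v\<close> to \<open>- 1 - v\<close>, which preserves \<open>v^2 + v\<close>;
    \<open>n\<close> changes by the odd number \<open>2 d + 1\<close>.\<close>
  proof (rule gen_series_eq_0[of "\<lambda>(n, d). (n + 2 * d + 1, - d - 1)"])
    show "bij_betw (\<lambda>(n, d). (n + 2 * d + 1, - d - 1)) (UNIV \<times> UNIV) (UNIV \<times> UNIV :: (int \<times> int) set)"
      by (rule bij_betw_byWitness[where f' = "\<lambda>(n, d). (n + 2 * d + 1, - d - 1)"]) auto
    fix x :: "int \<times> int"
    obtain n d where x: "x = (n, d)" by fastforce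
    show "(case case x of (n, d) \<Rightarrow> (n + 2 * d + 1, - d - 1) of (n, d) \<Rightarrow> theta_sign (- 1) n) =
      - (case x of (n, d) \<Rightarrow> theta_sign (- 1) n)"
      by (simp add: x theta_sign_def)
    have "int (e (n + 2 * d + 1 + 1 + 3 * (- d - 1), n + 2 * d + 1)) = int (e (n + 1 + 3 * d, n))"
      unfolding int_e by (simp add: power2_eq_square algebra_simps)
    then show "(case case x of (n, d) \<Rightarrow> (n + 2 * d + 1, - d - 1) of (n, d) \<Rightarrow> e (n + 1 + 3 * d, n)) =
      (case x of (n, d) \<Rightarrow> e (n + 1 + 3 * d, n))"
      by (simp only: x prod.case of_nat_eq_iff)
  qed
  finally show ?thesis
    unfolding quintuple_def theta_def distrib_right
    by (subst (1 2) gen_series_mult) (auto intro: finite_fibres_exp_r finite_fibres_exp_s finite_fibres_theta)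
qed

section \<open>Product manipulations leading to \<open>P(q) f(q) = P(q^2) g(q)\<close>\<close>

lemma pentagonal_20: "theta (- 1) 60 20 = qprod (- 1) 20 20"
proof -
  have "(\<Prod>i<3. f i) = f 0 * f 1 * f 2" for f :: "nat \<Rightarrow> int fps"
    by (simp add: eval_nat_numeral)
  \<comment> \<open>The exponents congruent to 20, 40 and 60 modulo 60 are all multiples of 20:
    Euler's pentagonal number theorem in \<open>q^20\<close>.\<close>
  then show ?thesis
    using jacobi_triple_product[of 20 60 "- 1"] qprod_split[of 20 20 3 "- 1"]
    by (simp add: mult_ac)
qed

text \<open>After multiplication by \<open>(q^20; q^20)\<close>, both sides are split by residues
  into the same factors with steps 5, 10 and 20.\<close>

lemma theta_eq_quintuple:
  "theta (- 1) 5 1 * qprod (- 1) 2 2 = quintuple * qprod (- 1) 1 1"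
proof -
  have prod2: "(\<Prod>i<2. f i) = f 0 * f 1" and prod5: "(\<Prod>i<5. f i) = f 0 * f 1 * f 2 * f 3 * f 4"
    for f :: "nat \<Rightarrow> int fps" by (simp_all add: eval_nat_numeral)
  let ?q = "qprod (- 1)" and ?p = "qprod 1"
  have t51: "theta (- 1) 5 1 = ?q 5 5 * (?q 5 1 * ?q 5 4)"
    using jacobi_triple_product[of 1 5 "- 1"] by simp
  have t107: "theta 1 10 7 = ?q 10 10 * (?p 10 7 * ?p 10 3)"
    using jacobi_triple_product[of 7 10 1] by simp
  have t204: "theta (- 1) 20 4 = ?q 20 20 * (?q 20 4 * ?q 20 16)"
    using jacobi_triple_product[of 4 20 "- 1"] by simp
  have E1: "?q 1 1 = ?q 5 1 * ?q 5 2 * ?q 5 3 * ?q 5 4 * ?q 5 5"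
    using qprod_split[of 1 1 5 "- 1"] 
    by (simp add: prod5 del: One_nat_def plus_1_eq_Suc add_2_eq_Suc add_2_eq_Suc')
  have E2: "?q 2 2 = ?q 10 2 * ?q 10 4 * ?q 10 6 * ?q 10 8 * ?q 10 10"
    using qprod_split[of 2 2 5 "- 1"] 
    by (simp add: prod5 del: One_nat_def plus_1_eq_Suc add_2_eq_Suc add_2_eq_Suc')
  have s52: "?q 5 2 = ?q 10 2 * ?q 10 7" and s53: "?q 5 3 = ?q 10 3 * ?q 10 8"
    using qprod_split[of 5 2 2 "- 1"] qprod_split[of 5 3 2 "- 1"] by (simp_all add: prod2
      del: One_nat_def plus_1_eq_Suc add_2_eq_Suc add_2_eq_Suc')
  have s104: "?q 10 4 = ?q 20 4 * ?q 20 14" and s106: "?q 10 6 = ?q 20 6 * ?q 20 16"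
    using qprod_split[of 10 4 2 "- 1"] qprod_split[of 10 6 2 "- 1"] by (simp_all add: prod2)
  \<comment> \<open>These two products supply the factors with a plus sign that occur in
    \<open>theta 1 10 7\<close>.\<close>
  have s206: "?q 20 6 = ?p 10 3 * ?q 10 3" and s2014: "?q 20 14 = ?p 10 7 * ?q 10 7"
    using qprod_mult_neg[of 10 3 1] qprod_mult_neg[of 10 7 1] by simp_all
  have "theta (- 1) 5 1 * ?q 2 2 * ?q 20 20 = theta 1 10 7 * theta (- 1) 20 4 * ?q 1 1"
    unfolding t51 t107 t204 E1 E2 s52 s53 s104 s106 s206 s2014 by (simp only: mult_ac)
  also have "\<dots> = quintuple * ?q 1 1 * ?q 20 20"
    unfolding quintuple_product pentagonal_20 by (simp only: mult_ac)
  finally show ?thesis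
    by (rule iffD1[OF mult_right_cancel[OF qprod_nonzero], rotated]) simp
qed

lemma partition_series_theta:
  "partition_series 1 0 * theta (- 1) 5 1 = partition_series 2 0 * quintuple"
proof -
  let ?P = "partition_series 1 0" and ?Q = "partition_series 2 0" and ?f = "theta (- 1) 5 1"
  have P: "?P * qprod (- 1) 1 1 = 1" and Q: "?Q * qprod (- 1) 2 2 = 1"
    by (rule partition_series_mult_qprod; simp)+
  have "?P * ?f = ?P * ?f * (?Q * qprod (- 1) 2 2)" by (simp only: Q mult_1_right)
  also have "\<dots> = ?P * ?Q * (?f * qprod (- 1) 2 2)" by (simp only: mult_ac)
  also have "\<dots> = ?Q * quintuple * (?P * qprod (- 1) 1 1)"
    unfolding theta_eq_quintuple by (simp only: mult_ac)
  finally show ?thesis unfolding P by (simp only: mult_1_right)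
qed


section \<open>Comparing coefficients\<close>

text \<open>Passes from coefficients to infinite sums: terms with \<open>e i > n\<close> vanish, so
  only finitely many remain, and none for negative \<open>n\<close>.\<close>

lemma has_sum_coeff:
  fixes p :: "int \<Rightarrow> int" and n :: int
  assumes "finite_fibres I e"
    and "\<And>m. m < 0 \<Longrightarrow> p m = 0" "\<And>m. p (int m) = F $ m"
  shows "((\<lambda>i. w i * p (n - int (e i))) has_sum
    (if n < 0 then 0 else (F * gen_series I w e) $ nat n)) I"
proof (cases "n < 0")
  case True
  then have "((\<lambda>i. w i * p (n - int (e i))) has_sum 0) I"
    by (intro has_sum_0) (simp add: assms(2))
  then show ?thesis using True by simp
next
  case False
  define N where "N = nat n"
  have n: "n = int N" using False by (simp add: N_def)
  let ?S = "{i \<in> I. e i \<le> N}"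
  have "((\<lambda>i. F $ (N - e i) * w i) has_sum (F * gen_series I w e) $ N) ?S"
    using finite_fibres_le[OF assms(1)] by (intro has_sum_finiteI) (simp_all add: mult_gen_series_nth[OF assms(1)])
  also have "?this \<longleftrightarrow> ((\<lambda>i. w i * p (n - int (e i))) has_sum (F * gen_series I w e) $ N) I"
  proof (rule has_sum_cong_neutral)
    fix i assume "i \<in> ?S \<inter> I"
    then have "n - int (e i) = int (N - e i)" by (simp add: n)
    then show "F $ (N - e i) * w i = w i * p (n - int (e i))" by (simp add: assms(3))
  qed (auto simp: n assms(2))
  finally show ?thesis using n by simp
qed

lemma partition_count_series: "partition_count (int m) = partition_series 1 0 $ m"
  by (simp add: partition_series_nth)

lemma partition_count_neg: "m < 0 \<Longrightarrow> partition_count m = 0"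
  by (simp add: partition_count_def)

text \<open>The coefficients of \<open>P(q^2)\<close>. The value 0 at odd arguments makes a sum over
  all indices select those of the right parity.\<close>

definition half_partition_count :: "int \<Rightarrow> int" where
  "half_partition_count m = (if even m then partition_count (m div 2) else 0)"

lemma half_partition_count_series: "half_partition_count (int m) = partition_series 2 0 $ m"
  by (simp add: partition_series_nth half_partition_count_def zdiv_int)

lemma half_partition_count_neg: "m < 0 \<Longrightarrow> half_partition_count m = 0"
  by (simp add: half_partition_count_def partition_count_neg)

text \<open>The two terms for \<open>j \<ge> 1\<close> belong to the indices \<open>j\<close> and
  \<open>- j\<close> of \<open>theta (- 1) 5 1\<close>, and \<open>p(n)\<close> to the index
  0.\<close>

lemma L_eq_coeff:
  "L n = (if n < 0 then 0 else (partition_series 1 0 * theta (- 1) 5 1) $ nat n)"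
proof -
  define g where "g j = theta_sign (- 1) j * partition_count (n - int (theta_exp 5 1 j))" for j
  have e: "j * (5 * j - 3) div 2 = int (theta_exp 5 1 j)" for j
  proof -
    have "j * (5 * j - 3) = 2 * int (theta_exp 5 1 j)"
      using int_theta_exp[of 1 5 j] by (simp add: algebra_simps)
    then show ?thesis by simp
  qed
  have e': "j * (5 * j + 3) div 2 = int (theta_exp 5 1 (- j))" for j
    using e[of "- j"] by (simp add: algebra_simps)
  have total: "(g has_sum (if n < 0 then 0 else (partition_series 1 0 * theta (- 1) 5 1) $ nat n)) UNIV"
    unfolding g_def theta_def
    by (intro has_sum_coeff finite_fibres_theta partition_count_neg partition_count_series) auto
  \<comment> \<open>Splitting an infinite sum requires summability on each piece; it holds since
    \<open>g\<close> has finite support.\<close>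
  have summ: "g summable_on A" for A
  proof (rule finite_nonzero_values_imp_summable_on)
    have "{j \<in> A. g j \<noteq> 0} \<subseteq> {j \<in> UNIV. theta_exp 5 1 j \<le> nat n}"
    proof
      fix j assume "j \<in> {j \<in> A. g j \<noteq> 0}"
      then have "\<not> n - int (theta_exp 5 1 j) < 0"
        using partition_count_neg by (auto simp: g_def)
      then show "j \<in> {j \<in> UNIV. theta_exp 5 1 j \<le> nat n}" by auto
    qed
    then show "finite {j \<in> A. g j \<noteq> 0}"
      by (rule finite_subset) (intro finite_fibres_le finite_fibres_theta; simp)
  qed
  have sgn: "(- 1) ^ nat j = theta_sign (- 1) j" if "j \<in> {1..}" for j :: int
    using that by (auto simp: theta_sign_def minus_one_power_iff even_nat_iff)
  have "(\<Sum>\<^sub>\<infinity>j\<in>{1..}. (- 1) ^ nat j *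
        (partition_count (n - j * (5 * j - 3) div 2) + partition_count (n - j * (5 * j + 3) div 2)))
      = (\<Sum>\<^sub>\<infinity>j\<in>{1..}. g j + g (- j))"
  proof (rule infsum_cong)
    fix j :: int assume j: "j \<in> {1..}"
    have "theta_sign (- 1) (- j) = theta_sign (- 1) j" by (simp add: theta_sign_def)
    then show "(- 1) ^ nat j *
        (partition_count (n - j * (5 * j - 3) div 2) + partition_count (n - j * (5 * j + 3) div 2))
      = g j + g (- j)"
      unfolding sgn[OF j] e e' g_def by (simp add: distrib_left)
  qed
  also have "\<dots> = infsum g {1..} + infsum g {..- 1}"
  proof -
    have b: "bij_betw uminus {1::int..} {..- 1}"
      by (rule bij_betw_byWitness[where f' = uminus]) auto
    have "(\<lambda>j. g (- j)) summable_on {1..}"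
      using summ summable_on_reindex_bij_betw[OF b, of g] by simp
    then show ?thesis
      using infsum_add[OF summ] infsum_reindex_bij_betw[OF b, of g] by simp
  qed
  finally have "L n = partition_count n + (infsum g {1..} + infsum g {..- 1})"
    by (simp add: L_def)
  also have "partition_count n = infsum g {0}"
    by (simp add: g_def theta_sign_def theta_exp_def)
  also have "infsum g {0} + (infsum g {1..} + infsum g {..- 1}) = infsum g ({0} \<union> ({1..} \<union> {..- 1}))"
    by (subst infsum_Un_disjoint; (subst infsum_Un_disjoint)?; (rule summ)?) auto
  also have "{0} \<union> ({1..} \<union> {..- 1}) = (UNIV :: int set)" by auto
  finally show ?thesis using infsumI[OF total] by simp
qed

section \<open>Splitting the sums by parity\<close>

lemma has_sum_exp_r:
  "((\<lambda>k. theta_sign (- 1) k * half_partition_count (n - int (exp_r k))) has_sum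
    (if n < 0 then 0 else (partition_series 2 0 * gen_series UNIV (theta_sign (- 1)) exp_r) $ nat n)) UNIV"
  and has_sum_exp_s:
  "((\<lambda>k. theta_sign (- 1) k * half_partition_count (n - int (exp_s k))) has_sum
    (if n < 0 then 0 else (partition_series 2 0 * gen_series UNIV (theta_sign (- 1)) exp_s) $ nat n)) UNIV"
  by (intro has_sum_coeff finite_fibres_exp_r finite_fibres_exp_s half_partition_count_neg
      half_partition_count_series; assumption)+

lemma even_exp_r: "even (exp_r k) \<longleftrightarrow> even k"
  and even_exp_s: "even (exp_s k) \<longleftrightarrow> odd k"
  unfolding even_of_nat_iff[where 'a = int, symmetric] int_exp_r int_exp_s by auto

lemma bij_betw_even: "bij_betw (\<lambda>i::int. 2 * i) UNIV {k. even k}"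
  by (rule bij_betw_byWitness[where f' = "\<lambda>k. k div 2"]) auto

lemma bij_betw_odd: "bij_betw (\<lambda>i::int. 2 * i + 1) UNIV {k. odd k}"
  by (rule bij_betw_byWitness[where f' = "\<lambda>k. k div 2"]) auto

lemma has_sum_int_even:
  assumes "(f has_sum x) UNIV" "\<And>k::int. odd k \<Longrightarrow> f k = 0"
  shows "((\<lambda>i. f (2 * i)) has_sum x) UNIV"
proof -
  have "(f has_sum x) {k. even k}"
    using assms by (subst has_sum_cong_neutral[of UNIV _ f f]) auto
  then show ?thesis using has_sum_reindex_bij_betw[OF bij_betw_even, of f x] by simp
qed

lemma has_sum_int_odd:
  assumes "(f has_sum x) UNIV" "\<And>k::int. even k \<Longrightarrow> f k = 0"
  shows "((\<lambda>i. f (2 * i + 1)) has_sum x) UNIV"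
proof -
  have "(f has_sum x) {k. odd k}"
    using assms by (subst has_sum_cong_neutral[of UNIV _ f f]) auto
  then show ?thesis using has_sum_reindex_bij_betw[OF bij_betw_odd, of f x] by simp
qed

text \<open>Since \<open>exp_s k\<close> has the parity opposite to \<open>k\<close>, even indices
  give \<open>s_o\<close> and odd ones \<open>s_e\<close>.\<close>

lemma exp_parts:
  "int (exp_r (2 * i)) = r_e i" "int (exp_r (2 * i + 1)) = r_o i"
  "int (exp_s (2 * i)) = s_o i" "int (exp_s (2 * i + 1)) = s_e i"
  unfolding int_exp_r int_exp_s r_e_def r_o_def s_e_def s_o_def
  by (simp_all add: power2_eq_square algebra_simps)

theorem theorem3:
  fixes n :: int
  shows "(even n \<longrightarrow>
            L n = (\<Sum>\<^sub>\<infinity>i::int. partition_count ((n - r_e i) div 2)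
                                   - partition_count ((n - s_e i) div 2)))
       \<and> (odd n \<longrightarrow>
            L n = (\<Sum>\<^sub>\<infinity>i::int. - partition_count ((n - r_o i) div 2)
                                   + partition_count ((n - s_o i) div 2)))"
proof -
  define p where "p = half_partition_count"
  define x where "x = (if n < 0 then 0 else (partition_series 2 0 * gen_series UNIV (theta_sign (- 1)) exp_r) $ nat n)"
  define y where "y = (if n < 0 then 0 else (partition_series 2 0 * gen_series UNIV (theta_sign (- 1)) exp_s) $ nat n)"
  have L: "L n = x + y"
    unfolding L_eq_coeff partition_series_theta quintuple_def x_def y_def by (simp add: distrib_left)
  note r = has_sum_exp_r[of n, folded x_def] and s = has_sum_exp_s[of n, folded y_def]
  have "L n = (\<Sum>\<^sub>\<infinity>i::int. partition_count ((n - r_e i) div 2) - partition_count ((n - s_e i) div 2))"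
    if n: "even n"
  proof -
    have ev: "even (r_e i)" "even (s_e i)" for i
      by (simp_all add: r_e_def s_e_def)
    \<comment> \<open>For even \<open>n\<close> only even exponents contribute: even
      \<open>k\<close> in \<open>exp_r\<close> with sign 1, odd \<open>k\<close> in
      \<open>exp_s\<close> with sign -1.\<close>
    have "((\<lambda>i. theta_sign (- 1) (2 * i) * half_partition_count (n - int (exp_r (2 * i)))) has_sum x) UNIV"
      using n by (intro has_sum_int_even[OF r]) (simp add: half_partition_count_def even_exp_r)
    moreover have "((\<lambda>i. theta_sign (- 1) (2 * i + 1) * half_partition_count (n - int (exp_s (2 * i + 1)))) has_sum y) UNIV"
      using n by (intro has_sum_int_odd[OF s]) (simp add: half_partition_count_def even_exp_s)
    ultimately have "((\<lambda>i. partition_count ((n - r_e i) div 2) + - partition_count ((n - s_e i) div 2)) has_sum (x + y)) UNIV"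
      unfolding exp_parts half_partition_count_def by (intro has_sum_add) (simp_all add: n ev theta_sign_def)
    then show ?thesis unfolding L by (simp add: infsumI)
  qed
  moreover have "L n = (\<Sum>\<^sub>\<infinity>i::int. - partition_count ((n - r_o i) div 2) + partition_count ((n - s_o i) div 2))"
    if n: "odd n"
  proof -
    have ev: "odd (r_o i)" "odd (s_o i)" for i
      by (simp_all add: r_o_def s_o_def)
    \<comment> \<open>For odd \<open>n\<close> the exponents must be odd, so now
      \<open>exp_r\<close> has odd \<open>k\<close> and the negative sign.\<close>
    have "((\<lambda>i. theta_sign (- 1) (2 * i + 1) * half_partition_count (n - int (exp_r (2 * i + 1)))) has_sum x) UNIV"
      using n by (intro has_sum_int_odd[OF r]) (simp add: half_partition_count_def even_exp_r)
    moreover have "((\<lambda>i. theta_sign (- 1) (2 * i) * half_partition_count (n - int (exp_s (2 * i)))) has_sum y) UNIV"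
      using n by (intro has_sum_int_even[OF s]) (simp add: half_partition_count_def even_exp_s)
    ultimately have "((\<lambda>i. - partition_count ((n - r_o i) div 2) + partition_count ((n - s_o i) div 2)) has_sum (x + y)) UNIV"
      unfolding exp_parts half_partition_count_def by (intro has_sum_add) (simp_all add: n ev theta_sign_def)
    then show ?thesis unfolding L by (simp add: infsumI)
  qed
  ultimately show ?thesis by blast
qed

end
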